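(* Consider a universe $\mathcal{U}$ of keys, where $|\mathcal{U}|$ is assumed to be a sufficiently large polynomial in $n$. If a dereference table with $n$ slots and keys from $\mathcal{U}$ supports variable-sized tiny pointers of expected size $s$ bits and load factor $1-\delta=\Omega(1)$, then $s=\Omega(\log\delta^{-1})$.
   Context: Dereference tables. A dereference table with $q$-bit values is a data structure supporting: $\mathrm{Create}(n,q)$, which creates a table with an array of $n$ slots of $q$ bits each, called the store; $\mathrm{Allocate}(k)$, which, given a key $k$, allocates a slot of the store to $k$ and returns a bit string $p$ called a tiny pointer; $\mathrm{Dereference}(k,p)$, which returns the index of the slot allocated to $k$ if $p$ is the tiny pointer returned by the most recent call $\mathrm{Allocate}(k)$ (and may return an arbitrary index if $p$ is not valid for $k$); and $\mathrm{Free}(k,p)$, called only on valid pairs, which deallocates slot $\mathrm{Dereference}(k,p)$. Each key holds at most one allocation at a time: after $\mathrm{Allocate}(k)$ returns $p$, $\mathrm{Free}(k,p)$ must be called before $\mathrm{Allocate}(k)$ is called again. A key is present if it has been allocated more recently than freed. Guarantees: for distinct present keys $k_1\ne k_2$ with tiny pointers $p_1,p_2$, $\mathrm{Dereference}(k_1,p_1)\neq \mathrm{Dereference}(k_2,p_2)$; and $\mathrm{Dereference}(k,p)$ depends only on $k$, $p$, random bits, and $n$. Load factor $1-\delta$ means the table supports up to $(1-\delta)n$ simultaneous allocations. Each allocation (made when fewer than $(1-\delta)n$ allocations are live) may fail with probability at most $1/\mathrm{poly}(n)$. The sequence of operations is chosen by an oblivious adversary (fixed in advance, independently of the table's random bits).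 "Variable-sized tiny pointers of expected size $s$" means that for every such sequence of operations, the tiny pointer returned by each allocation has expected length at most $s$ bits.
   Formalization: The range 1/n ≤ δ ≤ 1 is assumed for large n: for much smaller δ, e.g. δ = 2^(-n), the claim fails, since slot-index pointers of about log n bits always suffice; polynomially small δ < 1/n reduces to δ = 1/n. *)

theory Defs
  imports "HOL-Probability.Probability" "HOL-Library.Landau_Symbols"
begin

(* All random bits form one sample w :: 'r, drawn when the table is created.  The number n of
   slots and the value size q are seen by create, which may record them in the state 's;
   dereference sees only n, the random bits, the key and the tiny pointer, never the state.
   Result None of allocate is a failed allocation. *)
record ('k, 'r, 's) deref_table =
  rand :: "'r measure"
  create :: "nat \<Rightarrow> nat \<Rightarrow> 'r \<Rightarrow> 's"
  allocate :: "'r \<Rightarrow> 's \<Rightarrow> 'k \<Rightarrow> bool list option \<times> 's"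
  dereference :: "nat \<Rightarrow> 'r \<Rightarrow> 'k \<Rightarrow> bool list \<Rightarrow> nat"
  free :: "'r \<Rightarrow> 's \<Rightarrow> 'k \<Rightarrow> bool list \<Rightarrow> 's"

(* The oblivious adversary fixes a list of operations naming keys only; the pointer passed to
   free is the one the table returned.  Dereference does not change the state and is therefore
   not an operation here. *)
datatype 'k operation = Alloc 'k | Free 'k

(* L is the set of keys allocated more recently than freed according to the operation list.
   Since the list is fixed in advance, a key whose allocation failed still counts in L until
   its Free (which then does nothing), so the load bound also covers the keys truly present. *)
fun legal_from :: "'k set \<Rightarrow> real \<Rightarrow> 'k set \<Rightarrow> 'k operation list \<Rightarrow> bool" where
  "legal_from U cap L [] \<longleftrightarrow> True"
| "legal_from U cap L (Alloc k # ops) \<longleftrightarrow>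
     k \<in> U \<and> k \<notin> L \<and> real (card L) + 1 \<le> cap \<and> legal_from U cap (insert k L) ops"
| "legal_from U cap L (Free k # ops) \<longleftrightarrow>
     k \<in> L \<and> legal_from U cap (L - {k}) ops"

definition legal :: "'k set \<Rightarrow> nat \<Rightarrow> real \<Rightarrow> 'k operation list \<Rightarrow> bool" where
  "legal U n \<delta> ops \<longleftrightarrow> legal_from U ((1 - \<delta>) * real n) {} ops"

fun step :: "('k, 'r, 's) deref_table \<Rightarrow> 'r \<Rightarrow> 's \<times> ('k \<rightharpoonup> bool list) \<Rightarrow> 'k operation
    \<Rightarrow> 's \<times> ('k \<rightharpoonup> bool list)" where
  "step T w (\<sigma>, P) (Alloc k) =
     (case allocate T w \<sigma> k of
        (Some p, \<sigma>') \<Rightarrow> (\<sigma>', P(k \<mapsto> p))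
      | (None, \<sigma>') \<Rightarrow> (\<sigma>', P))"
| "step T w (\<sigma>, P) (Free k) =
     (case P k of
        Some p \<Rightarrow> (free T w \<sigma> k p, P(k := None))
      | None \<Rightarrow> (\<sigma>, P))"

(* The keys present after ops, with their tiny pointers. *)
definition pointers :: "('k, 'r, 's) deref_table \<Rightarrow> nat \<Rightarrow> nat \<Rightarrow> 'r \<Rightarrow> 'k operation list
    \<Rightarrow> ('k \<rightharpoonup> bool list)" where
  "pointers T n q w ops = snd (foldl (step T w) (create T n q w, Map.empty) ops)"

definition alloc_result :: "('k, 'r, 's) deref_table \<Rightarrow> nat \<Rightarrow> nat \<Rightarrow> 'k operation list \<Rightarrow> 'k
    \<Rightarrow> 'r \<Rightarrow> bool list option" where
  "alloc_result T n q ops k w = pointers T n q w (ops @ [Alloc k]) k"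

fun pointer_length :: "bool list option \<Rightarrow> real" where
  "pointer_length None = 0"
| "pointer_length (Some p) = real (length p)"

definition is_dereference_table ::
    "('k, 'r, 's) deref_table \<Rightarrow> 'k set \<Rightarrow> nat \<Rightarrow> nat \<Rightarrow> real \<Rightarrow> bool" where
  "is_dereference_table T U n q \<delta> \<longleftrightarrow>
     prob_space (rand T) \<and>
     (\<forall>ops k. legal U n \<delta> (ops @ [Alloc k]) \<longrightarrow>
        alloc_result T n q ops k \<in> measurable (rand T) (count_space UNIV)) \<and>
     (\<forall>ops w k p. legal U n \<delta> ops \<and> w \<in> space (rand T) \<and> pointers T n q w ops k = Some p \<longrightarrow>
        dereference T n w k p < n) \<and>
     (\<forall>ops w k1 k2 p1 p2.
        legal U n \<delta> ops \<and> w \<in> space (rand T) \<and> k1 \<noteq> k2 \<and>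
        pointers T n q w ops k1 = Some p1 \<and> pointers T n q w ops k2 = Some p2 \<longrightarrow>
        dereference T n w k1 p1 \<noteq> dereference T n w k2 p2)"

(* Legality is closed under prefixes, so ops @ [Alloc k] ranges over all allocations
   occurring in legal operation sequences. *)
definition supports_load_factor ::
    "('k, 'r, 's) deref_table \<Rightarrow> 'k set \<Rightarrow> nat \<Rightarrow> nat \<Rightarrow> real \<Rightarrow> real \<Rightarrow> bool" where
  "supports_load_factor T U n q \<delta> fail \<longleftrightarrow>
     (\<forall>ops k. legal U n \<delta> (ops @ [Alloc k]) \<longrightarrow>
        measure (rand T) {w \<in> space (rand T). alloc_result T n q ops k w = None} \<le> fail)"

definition expected_pointer_size_le ::
    "('k, 'r, 's) deref_table \<Rightarrow> 'k set \<Rightarrow> nat \<Rightarrow> nat \<Rightarrow> real \<Rightarrow> real \<Rightarrow> bool" where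
  "expected_pointer_size_le T U n q \<delta> s \<longleftrightarrow>
     (\<forall>ops k. legal U n \<delta> (ops @ [Alloc k]) \<longrightarrow>
        integrable (rand T) (\<lambda>w. pointer_length (alloc_result T n q ops k w)) \<and>
        (\<integral>w. pointer_length (alloc_result T n q ops k w) \<partial>rand T) \<le> s)"

end

theory Submission
  imports Defs "HOL-Real_Asymp.Real_Asymp"
begin

text \<open>
  The adversary fills the table with \<open>m\<close> keys and then keeps replacing a uniformly random live
  key by a uniformly random key that is not live. Fix the random bits. A slot is heavy if many
  pairs of a key and a short pointer dereference to it; only few slots are heavy. In the long run,
  keys leave heavy slots rarely, since few live keys sit there, so allocations into heavy slots
  are equally rare. A short pointer to a light slot must hit one of the about \<open>\<delta>n\<close> free slots,
  which is unlikely unless the number \<open>2 ^ l\<close> of short pointers is of order \<open>1 / \<delta>\<close>. If \<open>\<delta>\<close> is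
  bounded below, only the empty pointer counts as short, and it suffices that fresh keys collide
  with live ones with constant probability.
\<close>

text \<open>No random process is built: the adversary's coin flips become averages over finite sets
  of choices, so each expectation concerns one operation list fixed in advance, as obliviousness
  demands. The table may place keys adaptively, but \<open>dereference\<close> sees no state. Hence
  the heavy slots are determined by the random bits alone and do not move during the churn. This
  makes the number of live keys in heavy slots a bounded quantity; its net change over t steps is at
  most n, so its contribution per step vanishes as t grows. Failed allocations are the remaining
  obstacle: they widen the set of free slots beyond order \<delta> n. Their expected number is at
  most m times the failure bound, and since \<delta> \<ge> 1/n, a failure bound of order n^-a is of
  order \<delta>^a. Taking 2^l near \<delta>^(-a/2) (with a capped at 1) beats both terms and costs
  only a constant depending on a.\<close>

text \<open>
  The potential \<open>\<Phi>\<close> need not be measurable in \<open>w\<close>: it is used pointwise only. This matters because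
  nothing is assumed about measurability of \<^const>\<open>dereference\<close>.
\<close>
lemma drift_bound:
  fixes I :: "'a \<Rightarrow> 'i set" and nxt :: "'a \<Rightarrow> 'i \<Rightarrow> 'a" and r :: "'a \<Rightarrow> 'w \<Rightarrow> real"
  assumes M: "prob_space M"
    and g0: "g0 \<in> G"
    and I: "\<And>g. g \<in> G \<Longrightarrow> finite (I g) \<and> I g \<noteq> {}"
    and nxt: "\<And>g i. g \<in> G \<Longrightarrow> i \<in> I g \<Longrightarrow> nxt g i \<in> G"
    and int: "\<And>g. g \<in> G \<Longrightarrow> integrable M (r g)"
    and c: "\<And>g. g \<in> G \<Longrightarrow> c \<le> (\<integral>w. r g w \<partial>M)"
    and drift: "\<And>w g. w \<in> space M \<Longrightarrow> g \<in> G \<Longrightarrow>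
        r g w \<le> \<gamma> + (\<Sum>i\<in>I g. \<Phi> w g - \<Phi> w (nxt g i)) / card (I g)"
    and pos: "\<And>w g. w \<in> space M \<Longrightarrow> g \<in> G \<Longrightarrow> 0 \<le> \<Phi> w g"
    and bdd: "\<And>w. w \<in> space M \<Longrightarrow> \<Phi> w g0 \<le> B"
  shows "c \<le> \<gamma>"
proof -
  interpret prob_space M by (rule M)
  \<comment> \<open>\<open>V t g w\<close> is the total reward of \<open>t\<close> steps from
    history \<open>g\<close>, averaged over all sequences of choices; the recursion stands in for a
    product space of adversary coins.\<close>
  define V where "V = rec_nat (\<lambda>g w. 0)
    (\<lambda>t v g w. r g w + (\<Sum>i\<in>I g. v (nxt g i) w) / card (I g))"
  have V0: "V 0 g w = 0"
    and VS: "V (Suc t) g w = r g w + (\<Sum>i\<in>I g. V t (nxt g i) w) / card (I g)" for t g w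
    by (simp_all add: V_def)
  have upper: "V t g w \<le> real t * \<gamma> + \<Phi> w g" if "w \<in> space M" "g \<in> G" for t g w
    using that(2)
  proof (induction t arbitrary: g)
    case 0
    then show ?case using pos that by (simp add: V0)
  next
    case (Suc t)
    have N: "card (I g) > 0" using I Suc.prems by (simp add: card_gt_0_iff)
    have "(\<Sum>i\<in>I g. V t (nxt g i) w) \<le> (\<Sum>i\<in>I g. real t * \<gamma> + \<Phi> w (nxt g i))"
      using Suc nxt by (intro sum_mono) auto
    also have "\<dots> = real (card (I g)) * (real t * \<gamma> + \<Phi> w g)
        - (\<Sum>i\<in>I g. \<Phi> w g - \<Phi> w (nxt g i))"
      by (simp add: sum.distrib sum_subtractf algebra_simps)
    finally have "(\<Sum>i\<in>I g. V t (nxt g i) w) / card (I g) \<le> real t * \<gamma> + \<Phi> w g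
        - (\<Sum>i\<in>I g. \<Phi> w g - \<Phi> w (nxt g i)) / card (I g)"
      using N by (simp add: field_simps)
    then show ?case
      using drift[OF that(1) Suc.prems] by (simp add: VS algebra_simps)
  qed
  have lower: "integrable M (V t g) \<and> real t * c \<le> (\<integral>w. V t g w \<partial>M)" if "g \<in> G" for t g
    using that
  proof (induction t arbitrary: g)
    case 0
    then show ?case by (simp add: V0[abs_def])
  next
    case (Suc t)
    have N: "card (I g) > 0" using I Suc.prems by (simp add: card_gt_0_iff)
    have IH: "integrable M (V t (nxt g i))" "real t * c \<le> (\<integral>w. V t (nxt g i) w \<partial>M)"
      if "i \<in> I g" for i
      using Suc.IH nxt Suc.prems that by auto
    have "real (card (I g)) * (real t * c) \<le> (\<Sum>i\<in>I g. \<integral>w. V t (nxt g i) w \<partial>M)"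
      using IH(2) by (intro sum_bounded_below[where 'a = real, simplified]) auto
    then have "real t * c \<le> (\<Sum>i\<in>I g. \<integral>w. V t (nxt g i) w \<partial>M) / card (I g)"
      using N by (simp add: field_simps)
    then have "real (Suc t) * c \<le> (\<integral>w. r g w \<partial>M) + (\<integral>w. (\<Sum>i\<in>I g. V t (nxt g i) w) / card (I g) \<partial>M)"
      using c[OF Suc.prems] IH(1) by (simp add: Bochner_Integration.integral_sum algebra_simps)
    moreover have "V (Suc t) g = (\<lambda>w. r g w + (\<Sum>i\<in>I g. V t (nxt g i) w) / card (I g))"
      by (simp add: VS fun_eq_iff)
    ultimately show ?case
      using int[OF Suc.prems] IH(1) by simp
  qed
  \<comment> \<open>The potential is paid once, not once per step, so \<open>B\<close> does not grow
    with \<open>t\<close>. Under the integral only this constant appears.\<close>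
  have "real t * (c - \<gamma>) \<le> B" for t
  proof -
    have "real t * c \<le> (\<integral>w. V t g0 w \<partial>M)" using lower g0 by blast
    also have "\<dots> \<le> (\<integral>w. real t * \<gamma> + B \<partial>M)"
      using lower g0 upper bdd by (intro integral_mono) (force intro: order_trans)+
    finally show ?thesis by (simp add: prob_space algebra_simps)
  qed
  then show ?thesis
    using reals_Archimedean3[of "c - \<gamma>"] by (meson diff_gt_0_iff_gt linorder_not_less)
qed

subsection \<open>Operation sequences\<close>

text \<open>The set that \<open>legal_from\<close> carries as its argument \<open>L\<close>. It
  depends on the list alone, so it includes keys whose allocation failed.\<close>

definition live :: "'k operation list \<Rightarrow> 'k set" where
  "live ops = foldl (\<lambda>L op. case op of Alloc k \<Rightarrow> insert k L | Free k \<Rightarrow> L - {k}) {} ops"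

lemma live_simps [simp]:
  "live [] = {}"
  "live (ops @ [Alloc k]) = insert k (live ops)"
  "live (ops @ [Free k]) = live ops - {k}"
  by (simp_all add: live_def)

lemma legal_from_snoc:
  "legal_from U cap L (ops @ [op]) \<longleftrightarrow> legal_from U cap L ops \<and>
     legal_from U cap (foldl (\<lambda>L op. case op of Alloc k \<Rightarrow> insert k L | Free k \<Rightarrow> L - {k}) L ops) [op]"
proof (induction ops arbitrary: L)
  case Nil
  then show ?case by simp
next
  case (Cons a ops)
  then show ?case by (cases a) auto
qed

lemma legal_Nil [simp]: "legal U n \<delta> []"
  by (simp add: legal_def)

lemma legal_snoc_Alloc:
  "legal U n \<delta> (ops @ [Alloc k]) \<longleftrightarrow> legal U n \<delta> ops \<and> k \<in> U \<and> k \<notin> live ops \<and>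
     real (card (live ops)) + 1 \<le> (1 - \<delta>) * real n"
  unfolding legal_def legal_from_snoc by (auto simp: live_def)

lemma legal_snoc_Free:
  "legal U n \<delta> (ops @ [Free k]) \<longleftrightarrow> legal U n \<delta> ops \<and> k \<in> live ops"
  unfolding legal_def legal_from_snoc by (auto simp: live_def)

lemma legal_live_subset: "legal U n \<delta> ops \<Longrightarrow> live ops \<subseteq> U"
proof (induction ops rule: rev_induct)
  case (snoc op ops)
  then show ?case by (cases op) (auto simp: legal_snoc_Alloc legal_snoc_Free)
qed simp

lemma pointers_Nil [simp]: "pointers T n q w [] = Map.empty"
  by (simp add: pointers_def)

lemma pointers_snoc_Free [simp]:
  "pointers T n q w (ops @ [Free k]) = (pointers T n q w ops)(k := None)"
  unfolding pointers_def
  by (cases "foldl (step T w) (create T n q w, Map.empty) ops") (auto split: option.splits)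

text \<open>A failed allocation leaves the old entry of the map in place, so the uniform update is
  right only if that entry was \<open>None\<close>.\<close>

lemma pointers_snoc_Alloc:
  assumes "pointers T n q w ops k = None"
  shows "pointers T n q w (ops @ [Alloc k]) =
    (pointers T n q w ops)(k := alloc_result T n q ops k w)"
  using assms unfolding alloc_result_def pointers_def
  by (cases "foldl (step T w) (create T n q w, Map.empty) ops")
     (auto split: option.splits prod.splits simp: fun_upd_idem)

lemma pointers_not_live:
  "legal U n \<delta> ops \<Longrightarrow> k \<notin> live ops \<Longrightarrow> pointers T n q w ops k = None"
proof (induction ops arbitrary: k rule: rev_induct)
  case (snoc op ops)
  then show ?case
    by (cases op) (auto simp: legal_snoc_Alloc legal_snoc_Free pointers_snoc_Alloc)
qed simp

text \<open>The entry of a live key stems from its last allocation. Since liveness is fixed by the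
  list, the same \<open>ops'\<close> serves all \<open>w\<close>, which lets expectations be
  transferred.\<close>

lemma pointers_live:
  assumes "legal U n \<delta> ops" "k \<in> live ops"
  shows "\<exists>ops'. legal U n \<delta> (ops' @ [Alloc k]) \<and>
    (\<forall>w. pointers T n q w ops k = alloc_result T n q ops' k w)"
  using assms
proof (induction ops rule: rev_induct)
  case (snoc op ops)
  show ?case
  proof (cases op)
    case (Alloc j)
    have L: "legal U n \<delta> ops" "j \<notin> live ops"
      using snoc.prems Alloc by (auto simp: legal_snoc_Alloc)
    show ?thesis
    proof (cases "j = k")
      case True
      then show ?thesis using snoc.prems Alloc by (auto simp: alloc_result_def)
    next
      case False
      then have "k \<in> live ops" using snoc.prems Alloc by auto
      from snoc.IH[OF L(1) this] show ?thesis
        using False Alloc pointers_not_live[OF L, of T q] by (simp add: pointers_snoc_Alloc)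
    qed
  next
    case (Free j)
    then show ?thesis using snoc by (auto simp: legal_snoc_Free)
  qed
qed simp

lemma finite_live [simp]: "finite (live ops)"
proof (induction ops rule: rev_induct)
  case (snoc op ops)
  then show ?case by (cases op) auto
qed simp

subsection \<open>The churning adversary\<close>

locale churn =
  fixes T :: "('k, 'r, 's) deref_table" and U :: "'k set" and n q :: nat and \<delta> :: real
    and m :: nat
  assumes table: "is_dereference_table T U n q \<delta>"
    and finite_U: "finite U"
    and m_pos: "0 < m"
    and m_cap: "real m \<le> (1 - \<delta>) * real n"
    and m_less: "m < card U"
begin

definition good :: "'k operation list \<Rightarrow> bool" where
  "good ops \<longleftrightarrow> legal U n \<delta> ops \<and> card (live ops) = m"

text \<open>The new key is taken from outside \<open>live ops\<close> as it was before the removal.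
  It thus differs from the removed key, and the choices form a product.\<close>

definition choices :: "'k operation list \<Rightarrow> ('k \<times> 'k) set" where
  "choices ops = live ops \<times> (U - live ops)"

definition swap :: "'k operation list \<Rightarrow> 'k \<times> 'k \<Rightarrow> 'k operation list" where
  "swap ops i = ops @ [Free (fst i), Alloc (snd i)]"

definition outcome :: "'k operation list \<Rightarrow> 'k \<times> 'k \<Rightarrow> 'r \<Rightarrow> bool list option" where
  "outcome ops i = alloc_result T n q (ops @ [Free (fst i)]) (snd i)"

definition located :: "'r \<Rightarrow> nat set \<Rightarrow> 'k operation list \<Rightarrow> 'k set" where
  "located w X ops = {k. \<exists>p. pointers T n q w ops k = Some p \<and> dereference T n w k p \<in> X}"

text \<open>These keys count towards \<open>m\<close> without occupying a slot, so each of them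
  leaves one more slot free.\<close>

definition failed :: "'r \<Rightarrow> 'k operation list \<Rightarrow> 'k set" where
  "failed w ops = {k \<in> live ops. pointers T n q w ops k = None}"

definition short :: "nat \<Rightarrow> bool list option \<Rightarrow> bool" where
  "short l r \<longleftrightarrow> (\<exists>p. r = Some p \<and> length p \<le> l)"

section \<open>Guarantees of the table, and histories with exactly \<open>m\<close> live
  keys\<close>

lemma prob_space_rand: "prob_space (rand T)"
  using table by (simp add: is_dereference_table_def)

lemma measurable_alloc_result:
  "legal U n \<delta> (ops @ [Alloc k]) \<Longrightarrow>
     alloc_result T n q ops k \<in> measurable (rand T) (count_space UNIV)"
  using table by (simp add: is_dereference_table_def)

lemma slot_less:
  "legal U n \<delta> ops \<Longrightarrow> w \<in> space (rand T) \<Longrightarrow> pointers T n q w ops k = Some p \<Longrightarrow>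
     dereference T n w k p < n"
  using table unfolding is_dereference_table_def by blast

lemma slots_distinct:
  "legal U n \<delta> ops \<Longrightarrow> w \<in> space (rand T) \<Longrightarrow>
     pointers T n q w ops k1 = Some p1 \<Longrightarrow> pointers T n q w ops k2 = Some p2 \<Longrightarrow>
     dereference T n w k1 p1 = dereference T n w k2 p2 \<Longrightarrow> k1 = k2"
  using table unfolding is_dereference_table_def by blast

lemma good_exists: "\<exists>ops. good ops"
proof -
  have "j \<le> m \<Longrightarrow> \<exists>ops. legal U n \<delta> ops \<and> card (live ops) = j" for j
  proof (induction j)
    case 0
    show ?case by (intro exI[of _ "[]"]) simp
  next
    case (Suc j)
    then obtain ops where ops: "legal U n \<delta> ops" "card (live ops) = j" by auto
    have "card (live ops) < card U" using ops Suc.prems m_less by simp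
    then have "\<not> U \<subseteq> live ops"
      by (meson card_mono finite_live linorder_not_less)
    then obtain k where k: "k \<in> U" "k \<notin> live ops" by blast
    have "real (Suc j) \<le> real m" using Suc.prems by simp
    then have "real (card (live ops)) + 1 \<le> (1 - \<delta>) * real n" using m_cap ops by simp
    then show ?case using ops k by (intro exI[of _ "ops @ [Alloc k]"]) (simp add: legal_snoc_Alloc)
  qed
  then show ?thesis unfolding good_def by blast
qed

lemma good_legal: "good ops \<Longrightarrow> legal U n \<delta> ops"
  and good_card: "good ops \<Longrightarrow> card (live ops) = m"
  by (simp_all add: good_def)

lemma good_card_diff:
  assumes "good ops" shows "card (U - live ops) = card U - m"
  using assms by (simp add: card_Diff_subset good_card legal_live_subset[OF good_legal])

lemma card_choices: "good ops \<Longrightarrow> card (choices ops) = m * (card U - m)"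
  by (simp add: choices_def card_cartesian_product good_card good_card_diff)

lemma finite_choices: "finite (choices ops)"
  by (simp add: choices_def finite_U)

lemma card_choices_pos: "good ops \<Longrightarrow> 0 < card (choices ops)"
  using m_pos m_less by (simp add: card_choices)

lemma swap_eq: "swap ops i = (ops @ [Free (fst i)]) @ [Alloc (snd i)]"
  by (simp add: swap_def)

lemma legal_swap:
  assumes "good ops" "i \<in> choices ops"
  shows "legal U n \<delta> ((ops @ [Free (fst i)]) @ [Alloc (snd i)])"
proof -
  have "real (card (live ops - {fst i})) + 1 = real m"
    using assms m_pos by (simp add: choices_def mem_Times_iff good_card card_Diff_singleton)
  then show ?thesis
    using assms m_cap unfolding legal_snoc_Alloc legal_snoc_Free
    by (simp add: choices_def mem_Times_iff good_legal)
qed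

lemma good_swap:
  assumes "good ops" "i \<in> choices ops" shows "good (swap ops i)"
proof -
  have "card (live (swap ops i)) = m"
    using assms m_pos
    by (auto simp: swap_eq simp del: append_assoc
        simp: choices_def mem_Times_iff good_card card_Diff_singleton card_insert_if)
  then show ?thesis using legal_swap[OF assms] by (simp add: good_def swap_eq)
qed

lemma pointers_swap:
  assumes "good ops" "i \<in> choices ops"
  shows "pointers T n q w (swap ops i) =
    (pointers T n q w ops)(fst i := None, snd i := outcome ops i w)"
proof -
  have L: "legal U n \<delta> (ops @ [Free (fst i)])" "snd i \<notin> live (ops @ [Free (fst i)])"
    using legal_swap[OF assms] unfolding legal_snoc_Alloc by auto
  show ?thesis
    unfolding swap_eq outcome_def
    by (simp add: pointers_snoc_Alloc[OF pointers_not_live[OF L]] del: append_assoc)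
qed

section \<open>Flow of live keys into and out of a set of slots\<close>

lemma located_subset_live: "legal U n \<delta> ops \<Longrightarrow> located w X ops \<subseteq> live ops"
  unfolding located_def using pointers_not_live[of U n \<delta> ops _ T q w] by force

lemma card_located_le:
  assumes "legal U n \<delta> ops" "w \<in> space (rand T)" "finite X"
  shows "card (located w X ops) \<le> card X"
proof (rule card_inj_on_le)
  show "inj_on (\<lambda>k. dereference T n w k (the (pointers T n q w ops k))) (located w X ops)"
    by (rule inj_onI) (auto simp: located_def intro: slots_distinct[OF assms(1,2)])
qed (auto simp: located_def assms)

text \<open>Conservation law of the churn: net change is inflow minus outflow. The additive form
  avoids truncated subtraction on \<open>nat\<close>.\<close>

lemma card_located_swap:
  assumes "good ops" "i \<in> choices ops"
  shows "card (located w X (swap ops i)) + of_bool (fst i \<in> located w X ops) =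
    card (located w X ops) +
    of_bool (\<exists>p. outcome ops i w = Some p \<and> dereference T n w (snd i) p \<in> X)"
proof -
  have sub: "located w X ops \<subseteq> live ops"
    using assms(1) by (simp add: located_subset_live good_legal)
  then have fin: "finite (located w X ops)" by (rule finite_subset) simp
  have i: "fst i \<in> live ops" "snd i \<notin> live ops"
    using assms(2) by (auto simp: choices_def)
  have eq: "located w X (swap ops i) = (located w X ops - {fst i}) \<union>
      (if \<exists>p. outcome ops i w = Some p \<and> dereference T n w (snd i) p \<in> X then {snd i} else {})"
    using i sub by (auto simp: located_def pointers_swap[OF assms] split: if_splits)
  have "snd i \<notin> located w X ops" using i sub by auto
  moreover have "fst i \<in> located w X ops \<Longrightarrow> 0 < card (located w X ops)"
    using fin by (auto simp: card_gt_0_iff)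
  ultimately show ?thesis
    using fin by (auto simp: eq card_insert_if card_Diff_singleton_if)
qed

text \<open>The failure bound speaks of the moment of allocation; \<open>pointers_live\<close>
  extends it to every later time at which the key is still live.\<close>

lemma prob_pointer_None:
  assumes "supports_load_factor T U n q \<delta> \<phi>" "legal U n \<delta> ops" "k \<in> live ops"
  shows "integrable (rand T) (\<lambda>w. of_bool (pointers T n q w ops k = None) :: real)"
    and "(\<integral>w. of_bool (pointers T n q w ops k = None) \<partial>rand T) \<le> \<phi>"
proof -
  interpret prob_space "rand T" by (rule prob_space_rand)
  obtain ops' where ops': "legal U n \<delta> (ops' @ [Alloc k])"
    "\<And>w. pointers T n q w ops k = alloc_result T n q ops' k w"
    using pointers_live[OF assms(2,3)] by blast
  note [measurable] = measurable_alloc_result[OF ops'(1)]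
  define A where "A = {w \<in> space (rand T). alloc_result T n q ops' k w = None}"
  have A: "A \<in> sets (rand T)" unfolding A_def by measurable
  have ind: "indicator A w = (of_bool (pointers T n q w ops k = None) :: real)"
    if "w \<in> space (rand T)" for w
    using that by (simp add: A_def ops'(2) indicator_def)
  have "integrable (rand T) (indicator A :: _ \<Rightarrow> real)"
    using A by (simp add: less_top[symmetric])
  moreover have "integrable (rand T) (indicator A :: _ \<Rightarrow> real) \<longleftrightarrow>
      integrable (rand T) (\<lambda>w. of_bool (pointers T n q w ops k = None) :: real)"
    by (rule Bochner_Integration.integrable_cong) (simp_all add: ind)
  ultimately show "integrable (rand T) (\<lambda>w. of_bool (pointers T n q w ops k = None) :: real)"
    by blast
  have "(\<integral>w. of_bool (pointers T n q w ops k = None) \<partial>rand T) =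
      (\<integral>w. indicator A w \<partial>rand T :: real)"
    by (rule Bochner_Integration.integral_cong[OF refl]) (rule ind[symmetric])
  also have "\<dots> = measure (rand T) A" using A by simp
  also have "\<dots> \<le> \<phi>"
    using assms(1) ops'(1) unfolding supports_load_factor_def A_def by blast
  finally show "(\<integral>w. of_bool (pointers T n q w ops k = None) \<partial>rand T) \<le> \<phi>" .
qed

text \<open>Separates probability from counting: what remains to be shown is an inequality for fixed
  random bits \<open>w\<close>. There \<open>X\<close> may depend on \<open>w\<close> but not on the
  history, since otherwise the count of located keys would not telescope.\<close>

lemma churn_bound:
  fixes \<kappa> b \<gamma> \<phi> \<sigma> :: real and l :: nat
  assumes load: "supports_load_factor T U n q \<delta> \<phi>"
    and size: "expected_pointer_size_le T U n q \<delta> \<sigma>"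
    and "0 \<le> \<kappa>" "0 \<le> b"
    and drift: "\<And>w. w \<in> space (rand T) \<Longrightarrow> \<exists>X\<subseteq>{..<n}. \<forall>ops. good ops \<longrightarrow>
      (\<Sum>i\<in>choices ops. of_bool (short l (outcome ops i w))) \<le>
        (\<gamma> + \<kappa> * card (failed w ops)) * card (choices ops) +
        b * (\<Sum>i\<in>choices ops. real (card (located w X (swap ops i))) - card (located w X ops))"
  shows "1 - \<phi> - \<sigma> / (real l + 1) - \<kappa> * m * \<phi> \<le> \<gamma>"
proof -
  interpret prob_space "rand T" by (rule prob_space_rand)
  obtain ops0 where ops0: "good ops0" using good_exists by blast
  obtain X where X: "X w \<subseteq> {..<n}" and XD: "good ops \<Longrightarrow>
      (\<Sum>i\<in>choices ops. of_bool (short l (outcome ops i w))) \<le>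
        (\<gamma> + \<kappa> * card (failed w ops)) * card (choices ops) +
        b * (\<Sum>i\<in>choices ops. real (card (located w (X w) (swap ops i))) - card (located w (X w) ops))"
      if "w \<in> space (rand T)" for w ops
    using drift by metis
  \<comment> \<open>Markov's inequality in linear form: \<rho> is at most 0 unless the pointer is
    short, and its expectation follows directly from the bounds on failure and length.\<close>
  define \<rho> where "\<rho> ops i w = 1 - of_bool (outcome ops i w = None)
      - pointer_length (outcome ops i w) / (real l + 1)" for ops i w
  define r where "r ops w = (\<Sum>i\<in>choices ops. \<rho> ops i w) / card (choices ops)
      - \<kappa> * card (failed w ops)" for ops w
  have \<rho>_short: "\<rho> ops i w \<le> of_bool (short l (outcome ops i w))" for ops i w
    by (cases "outcome ops i w") (auto simp: \<rho>_def short_def field_simps)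
  have \<rho>: "integrable (rand T) (\<rho> ops i)" "1 - \<phi> - \<sigma> / (real l + 1) \<le> (\<integral>w. \<rho> ops i w \<partial>rand T)"
    if "good ops" "i \<in> choices ops" for ops i
  proof -
    have L: "legal U n \<delta> ((ops @ [Free (fst i)]) @ [Alloc (snd i)])" by (rule legal_swap[OF that])
    have 1: "integrable (rand T) (\<lambda>w. pointer_length (outcome ops i w))"
        "(\<integral>w. pointer_length (outcome ops i w) \<partial>rand T) \<le> \<sigma>"
      using size L unfolding expected_pointer_size_le_def outcome_def by blast+
    have 2: "outcome ops i w = pointers T n q w ((ops @ [Free (fst i)]) @ [Alloc (snd i)]) (snd i)" for w
      by (simp add: outcome_def alloc_result_def)
    have 3: "integrable (rand T) (\<lambda>w. of_bool (outcome ops i w = None) :: real)"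
        "(\<integral>w. of_bool (outcome ops i w = None) \<partial>rand T) \<le> \<phi>"
      unfolding 2 by (rule prob_pointer_None[OF load L], simp del: append_assoc)+
    show "integrable (rand T) (\<rho> ops i)" unfolding \<rho>_def using 1 3 by simp
    have "(\<integral>w. \<rho> ops i w \<partial>rand T) = 1 - (\<integral>w. of_bool (outcome ops i w = None) \<partial>rand T)
        - (\<integral>w. pointer_length (outcome ops i w) \<partial>rand T) / (real l + 1)"
      unfolding \<rho>_def using 1 3 by (simp add: prob_space)
    moreover have "(\<integral>w. pointer_length (outcome ops i w) \<partial>rand T) / (real l + 1) \<le> \<sigma> / (real l + 1)"
      using 1 by (simp add: divide_right_mono)
    ultimately show "1 - \<phi> - \<sigma> / (real l + 1) \<le> (\<integral>w. \<rho> ops i w \<partial>rand T)" using 3 by simp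
  qed
  have failed_eq: "real (card (failed w ops)) =
      (\<Sum>k\<in>live ops. of_bool (pointers T n q w ops k = None))" for w ops
    by (simp add: failed_def Int_def)
  have failed: "integrable (rand T) (\<lambda>w. real (card (failed w ops)))"
      "(\<integral>w. real (card (failed w ops)) \<partial>rand T) \<le> m * \<phi>" if "good ops" for ops
  proof -
    note P = prob_pointer_None[OF load good_legal[OF that]]
    show "integrable (rand T) (\<lambda>w. real (card (failed w ops)))"
      unfolding failed_eq using P by (intro Bochner_Integration.integrable_sum) auto
    have "(\<integral>w. real (card (failed w ops)) \<partial>rand T) =
        (\<Sum>k\<in>live ops. \<integral>w. of_bool (pointers T n q w ops k = None) \<partial>rand T)"
      unfolding failed_eq using P by (subst Bochner_Integration.integral_sum) auto
    also have "\<dots> \<le> (\<Sum>k\<in>live ops. \<phi>)" using P by (intro sum_mono) auto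
    finally show "(\<integral>w. real (card (failed w ops)) \<partial>rand T) \<le> m * \<phi>"
      using that by (simp add: good_card)
  qed
  show ?thesis
  \<comment> \<open>At most \<open>n\<close> keys are located in \<open>X w\<close>, as slots are
    distinct, so this potential lies between 0 and \<open>b * n\<close>; its decrease is
    \<open>b\<close> times the net inflow into \<open>X w\<close>.\<close>
  proof (rule drift_bound[where M = "rand T" and G = "{ops. good ops}" and I = choices and nxt = swap
        and r = r and \<Phi> = "\<lambda>w ops. b * (real n - card (located w (X w) ops))" and B = "b * n"
        and ?g0.0 = ops0])
    show "prob_space (rand T)" by (rule prob_space_rand)
    show "ops0 \<in> {ops. good ops}" using ops0 by simp
    show "finite (choices g) \<and> choices g \<noteq> {}" if "g \<in> {ops. good ops}" for g
      using that card_choices_pos[of g] finite_choices by (auto simp: card_gt_0_iff)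
    show "swap g i \<in> {ops. good ops}" if "g \<in> {ops. good ops}" "i \<in> choices g" for g i
      using that good_swap by simp
  next
    fix g assume "g \<in> {ops. good ops}"
    then have g: "good g" by simp
    show "integrable (rand T) (r g)"
      unfolding r_def using \<rho>(1)[OF g] failed(1)[OF g] by auto
    have "card (choices g) * (1 - \<phi> - \<sigma> / (real l + 1)) \<le> (\<Sum>i\<in>choices g. \<integral>w. \<rho> g i w \<partial>rand T)"
      using \<rho>(2)[OF g] by (intro sum_bounded_below[where 'a = real, simplified]) auto
    then have "1 - \<phi> - \<sigma> / (real l + 1) \<le> (\<Sum>i\<in>choices g. \<integral>w. \<rho> g i w \<partial>rand T) / card (choices g)"
      using card_choices_pos[OF g] by (simp add: field_simps)
    moreover have "(\<integral>w. r g w \<partial>rand T) = (\<Sum>i\<in>choices g. \<integral>w. \<rho> g i w \<partial>rand T) / card (choices g)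
        - \<kappa> * (\<integral>w. real (card (failed w g)) \<partial>rand T)"
      unfolding r_def using \<rho>(1)[OF g] failed(1)[OF g]
      by (simp add: Bochner_Integration.integral_sum)
    moreover have "\<kappa> * (\<integral>w. real (card (failed w g)) \<partial>rand T) \<le> \<kappa> * (m * \<phi>)"
      using failed(2)[OF g] \<open>0 \<le> \<kappa>\<close> by (rule mult_left_mono)
    ultimately show "1 - \<phi> - \<sigma> / (real l + 1) - \<kappa> * m * \<phi> \<le> (\<integral>w. r g w \<partial>rand T)"
      by (simp add: mult.assoc)
  next
    fix w g assume w: "w \<in> space (rand T)" and "g \<in> {ops. good ops}"
    then have g: "good g" by simp
    have N: "0 < real (card (choices g))" using card_choices_pos[OF g] by simp
    have "(\<Sum>i\<in>choices g. \<rho> g i w) \<le> (\<Sum>i\<in>choices g. of_bool (short l (outcome g i w)))"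
      by (rule sum_mono[OF \<rho>_short])
    also have "\<dots> \<le> (\<gamma> + \<kappa> * card (failed w g)) * card (choices g) +
        b * (\<Sum>i\<in>choices g. real (card (located w (X w) (swap g i))) - card (located w (X w) g))"
      by (rule XD[OF w g])
    also have "b * (\<Sum>i\<in>choices g. real (card (located w (X w) (swap g i))) - card (located w (X w) g))
       = (\<Sum>i\<in>choices g. b * (real n - card (located w (X w) g)) -
          b * (real n - card (located w (X w) (swap g i))))"
      by (simp add: sum_distrib_left algebra_simps)
    finally have "(\<Sum>i\<in>choices g. \<rho> g i w) \<le>
        (\<gamma> + \<kappa> * card (failed w g)) * card (choices g) +
        (\<Sum>i\<in>choices g. b * (real n - card (located w (X w) g)) -
          b * (real n - card (located w (X w) (swap g i))))" (is "_ \<le> _ + ?D") .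
    then have "(\<Sum>i\<in>choices g. \<rho> g i w) / card (choices g) \<le>
        ((\<gamma> + \<kappa> * card (failed w g)) * card (choices g) + ?D) / card (choices g)"
      using N by (intro divide_right_mono) auto
    then show "r g w \<le> \<gamma> + (\<Sum>i\<in>choices g. b * (real n - card (located w (X w) g)) -
          b * (real n - card (located w (X w) (swap g i)))) / card (choices g)"
      unfolding r_def using N by (simp add: add_divide_distrib)
    have "card (located w (X w) g) \<le> card (X w)"
      using good_legal[OF g] w finite_subset[OF X] by (intro card_located_le) auto
    also have "\<dots> \<le> n" using card_mono[OF _ X[OF w]] by simp
    finally show "0 \<le> b * (real n - card (located w (X w) g))" using \<open>0 \<le> b\<close> by simp
  next
    show "b * (real n - card (located w (X w) ops0)) \<le> b * n" for w
      using \<open>0 \<le> b\<close> by (intro mult_left_mono) auto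
  qed
qed

subsection \<open>Heavy and light slots\<close>

text \<open>A key is counted once even if several short strings lead it to \<open>x\<close>. No
  history occurs here, as \<open>dereference\<close> does not see the state.\<close>

definition reach :: "nat \<Rightarrow> 'r \<Rightarrow> nat \<Rightarrow> 'k set" where
  "reach l w x = {k \<in> U. \<exists>p. length p \<le> l \<and> dereference T n w k p = x}"

lemma finite_reach: "finite (reach l w x)"
  using finite_U by (simp add: reach_def)

text \<open>Double counting: a key together with a string determines one slot, and fewer than
  \<open>2 ^ (l + 1)\<close> strings have length at most \<open>l\<close>.\<close>

lemma sum_card_reach: "(\<Sum>x<n. card (reach l w x)) \<le> card U * 2 ^ (l + 1)"
proof -
  have S: "{p :: bool list. length p \<le> l} = {p. set p \<subseteq> UNIV \<and> length p \<le> l}" by simp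
  have finS: "finite {p :: bool list. length p \<le> l}"
    unfolding S by (rule finite_lists_length_le) simp
  have "card {p :: bool list. length p \<le> l} = (\<Sum>j\<le>l. 2 ^ j)"
    unfolding S by (subst card_lists_length_le) simp_all
  also have "\<dots> = 2 ^ Suc l - 1"
    by (induction l) simp_all
  finally have cardS: "card {p :: bool list. length p \<le> l} \<le> 2 ^ (l + 1)" by simp
  have "(\<Sum>x<n. card (reach l w x)) = card (SIGMA x:{..<n}. reach l w x)"
    by (simp add: finite_reach)
  also have "\<dots> \<le> card ((\<lambda>(k, p). (dereference T n w k p, k)) ` (U \<times> {p. length p \<le> l}))"
    using finite_U finS by (intro card_mono) (auto simp: reach_def image_iff)
  also have "\<dots> \<le> card (U \<times> {p :: bool list. length p \<le> l})"
    using finite_U finS by (intro card_image_le) simp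
  also have "\<dots> \<le> card U * 2 ^ (l + 1)"
    using cardS by (simp add: card_cartesian_product)
  finally show ?thesis .
qed

text \<open>The guarantees are applied to the history after the swap. There \<open>fst i\<close>
  holds no slot, so its old slot is the only formerly occupied one that the new key may
  take.\<close>

lemma outcome_slot:
  assumes "good ops" "i \<in> choices ops" "w \<in> space (rand T)" "outcome ops i w = Some p"
  shows "dereference T n w (snd i) p < n"
    and "\<And>k p'. k \<noteq> fst i \<Longrightarrow> pointers T n q w ops k = Some p' \<Longrightarrow>
      dereference T n w k p' \<noteq> dereference T n w (snd i) p"
proof -
  have L: "legal U n \<delta> (swap ops i)" using good_swap[OF assms(1,2)] by (rule good_legal)
  have P: "pointers T n q w (swap ops i) (snd i) = Some p"
    using assms by (simp add: pointers_swap)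
  show "dereference T n w (snd i) p < n" by (rule slot_less[OF L assms(3) P])
  fix k p' assume k: "k \<noteq> fst i" "pointers T n q w ops k = Some p'"
  have "snd i \<notin> live ops" using assms(2) by (auto simp: choices_def)
  then have "k \<noteq> snd i"
    using k pointers_not_live[OF good_legal[OF assms(1)], of "snd i" T q w] by auto
  moreover from this have "pointers T n q w (swap ops i) k = Some p'"
    using k assms by (simp add: pointers_swap)
  ultimately show "dereference T n w k p' \<noteq> dereference T n w (snd i) p"
    using slots_distinct[OF L assms(3) _ P] by blast
qed

definition slot :: "'r \<Rightarrow> 'k operation list \<Rightarrow> 'k \<Rightarrow> nat" where
  "slot w ops k = dereference T n w k (the (pointers T n q w ops k))"

lemma inj_on_slot:
  assumes "legal U n \<delta> ops" "w \<in> space (rand T)"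
  shows "inj_on (slot w ops) {k. pointers T n q w ops k \<noteq> None}"
  using slots_distinct[OF assms] by (auto simp: inj_on_def slot_def)

section \<open>Averages over the swaps\<close>

lemma sum_choices_fst:
  "good ops \<Longrightarrow> (\<Sum>i\<in>choices ops. f (fst i)) = real (card U - m) * (\<Sum>y\<in>live ops. f y :: real)"
  unfolding choices_def
  by (simp add: sum.cartesian_product' good_card_diff sum_distrib_left)

lemma sum_located:
  assumes "good ops"
  shows "(\<Sum>i\<in>choices ops. of_bool (fst i \<in> located w X ops)) =
    real (card U - m) * card (located w X ops)"
proof -
  have "live ops \<inter> located w X ops = located w X ops"
    using located_subset_live[OF good_legal[OF assms]] by blast
  then show ?thesis
    by (simp add: sum_choices_fst[OF assms, where f = "\<lambda>y. of_bool (y \<in> located w X ops)"])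
qed

lemma sum_choices_le:
  fixes f :: "'k \<times> 'k \<Rightarrow> real" and c :: real
  assumes "good ops" "\<And>y. y \<in> live ops \<Longrightarrow> (\<Sum>k\<in>U - live ops. f (y, k)) \<le> c"
  shows "(\<Sum>i\<in>choices ops. f i) \<le> m * c"
proof -
  have "(\<Sum>i\<in>choices ops. f i) = (\<Sum>y\<in>live ops. \<Sum>k\<in>U - live ops. f (y, k))"
    unfolding choices_def by (simp add: sum.cartesian_product')
  also have "\<dots> \<le> (\<Sum>y\<in>live ops. c)" using assms(2) by (rule sum_mono)
  finally show ?thesis using assms(1) by (simp add: good_card)
qed

lemma n_pos: "0 < n"
  using m_pos m_cap by (cases n) auto

lemma card_failed_le: "good ops \<Longrightarrow> card (failed w ops) \<le> m"
  unfolding failed_def by (metis (no_types, lifting) card_mono finite_live good_card mem_Collect_eq subsetI)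

text \<open>
  Every key that leaves a heavy slot must be replaced by a key entering one, so heavy slots can
  absorb only a small fraction of the allocations; the others must hit one of the few free light
  slots.
\<close>
lemma heavy_light_bound:
  fixes M \<phi> \<sigma> :: real
  assumes load: "supports_load_factor T U n q \<delta> \<phi>"
    and size: "expected_pointer_size_le T U n q \<delta> \<sigma>"
    and U_large: "2 * m \<le> card U" and M: "0 < M"
  shows "1 - \<phi> - \<sigma> / (real l + 1) - 2 * M / n * m * \<phi> \<le>
    n * 2 ^ (l + 1) / (M * m) + 2 * M / n * (real n - m + 1)"
proof (rule churn_bound[OF load size, where b = 1])
  \<comment> \<open>\<open>2 * M / n\<close> bounds the chance that a fresh key can reach a given
    light slot; it is charged once for each free slot, hence once for each failed key. The 2 arises
    because at least half of the universe is fresh.\<close>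
  show "0 \<le> 2 * M / n" using M by simp
next
  fix w assume w: "w \<in> space (rand T)"
  define u where "u = real (card U)"
  \<comment> \<open>\<open>M\<close> times the average number of keys per slot if each key had one
    pointer. By \<open>sum_card_reach\<close>, at most a fraction \<open>2 ^ (l + 1) / M\<close> of
    the slots exceeds it.\<close>
  define \<theta> where "\<theta> = M * u / n"
  define X where "X = {x \<in> {..<n}. \<theta> < card (reach l w x)}"
  have u: "0 < u" using m_less by (simp add: u_def)
  have \<theta>: "0 < \<theta>" using M u n_pos by (simp add: \<theta>_def)
  have "card X * \<theta> \<le> (\<Sum>x\<in>X. real (card (reach l w x)))"
    by (rule sum_bounded_below[where 'a = real, simplified]) (simp add: X_def)
  also have "\<dots> \<le> (\<Sum>x<n. real (card (reach l w x)))"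
    by (rule sum_mono2) (auto simp: X_def)
  also have "\<dots> \<le> u * 2 ^ (l + 1)"
    using of_nat_mono[OF sum_card_reach[of l w], where 'a = real] by (simp add: u_def)
  finally have X_card: "card X \<le> n * 2 ^ (l + 1) / M"
    using M u n_pos by (simp add: \<theta>_def field_simps)
  show "\<exists>X\<subseteq>{..<n}. \<forall>ops. good ops \<longrightarrow>
      (\<Sum>i\<in>choices ops. of_bool (short l (outcome ops i w))) \<le>
        (n * 2 ^ (l + 1) / (M * m) + 2 * M / n * (real n - m + 1) +
          2 * M / n * card (failed w ops)) * card (choices ops) +
        1 * (\<Sum>i\<in>choices ops. real (card (located w X (swap ops i))) - card (located w X ops))"
  proof (intro exI[of _ X] conjI allI impI)
    fix ops assume ops: "good ops"
    define P where "P = pointers T n q w ops"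
    define D where "D = {k. P k \<noteq> None}"
    \<comment> \<open>The slots that are free once \<open>y\<close> is removed; the slot given up by
      \<open>y\<close> itself causes the \<open>+ 1\<close> in \<open>F_card\<close>.\<close>
    define F where "F y = {..<n} - slot w ops ` (D - {y})" for y
    define R where "R y = {k \<in> U - live ops. \<exists>p. length p \<le> l \<and> dereference T n w k p \<in> F y - X}" for y
    define \<Delta> where "\<Delta> = (\<Sum>i\<in>choices ops. real (card (located w X (swap ops i))) - card (located w X ops))"
    have D: "D = live ops - failed w ops"
    proof (rule set_eqI)
      show "k \<in> D \<longleftrightarrow> k \<in> live ops - failed w ops" for k
        using pointers_not_live[OF good_legal[OF ops], of k T q w]
        unfolding D_def P_def failed_def by (cases "k \<in> live ops") simp_all
    qed
    have D_card: "card D = m - card (failed w ops)"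
    proof -
      have "failed w ops \<subseteq> live ops" by (auto simp: failed_def)
      then show ?thesis
        unfolding D using ops
        by (simp add: card_Diff_subset[OF finite_subset[OF _ finite_live]] good_card)
    qed
    have F_card: "real (card (F y)) \<le> real n - m + 1 + card (failed w ops)" for y
    proof -
      have inj: "inj_on (slot w ops) (D - {y})"
        using inj_on_slot[OF good_legal[OF ops] w] by (rule inj_on_subset) (auto simp: D_def P_def)
      have sub: "slot w ops ` (D - {y}) \<subseteq> {..<n}"
        using slot_less[OF good_legal[OF ops] w] by (auto simp: D_def P_def slot_def)
      have "finite D" unfolding D by simp
      have "card (D - {y}) + 1 \<ge> card D" using diff_card_le_card_Diff[of "{y}" D] by simp
      moreover have "card (F y) + card (D - {y}) = n"
        unfolding F_def using sub inj \<open>finite D\<close> card_mono[OF _ sub]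
        by (simp add: card_Diff_subset card_image)
      ultimately show ?thesis using D_card card_failed_le[OF ops, of w] by linarith
    qed
    have R_card: "real (card (R y)) \<le> (real n - m + 1 + card (failed w ops)) * \<theta>" for y
    proof -
      have fin: "finite (F y - X)" by (simp add: F_def)
      have "card (R y) \<le> card (\<Union>x\<in>F y - X. reach l w x)"
        using fin finite_reach by (intro card_mono) (auto simp: R_def reach_def)
      also have "\<dots> \<le> (\<Sum>x\<in>F y - X. card (reach l w x))" by (rule card_UN_le[OF fin])
      finally have "real (card (R y)) \<le> (\<Sum>x\<in>F y - X. real (card (reach l w x)))"
        by (metis of_nat_le_iff of_nat_sum)
      also have "\<dots> \<le> card (F y - X) * \<theta>"
        by (rule sum_bounded_above[where 'a = real, simplified]) (auto simp: X_def F_def)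
      also have "\<dots> \<le> card (F y) * \<theta>"
        using \<theta> by (intro mult_right_mono) (auto intro!: card_mono simp: F_def)
      also have "\<dots> \<le> (real n - m + 1 + card (failed w ops)) * \<theta>"
        using F_card[of y] \<theta> by (intro mult_right_mono) auto
      finally show ?thesis .
    qed
    \<comment> \<open>A short outcome in a heavy slot is inflow, that is, net change plus outflow;
      any other short outcome needs a free light slot within reach of the new key.\<close>
    have pt: "of_bool (short l (outcome ops i w)) \<le>
        (real (card (located w X (swap ops i))) - card (located w X ops)) +
        of_bool (fst i \<in> located w X ops) + of_bool (snd i \<in> R (fst i))" if i: "i \<in> choices ops" for i
    proof -
      have "real (card (located w X (swap ops i))) + of_bool (fst i \<in> located w X ops) =
          card (located w X ops) +
          of_bool (\<exists>p. outcome ops i w = Some p \<and> dereference T n w (snd i) p \<in> X)"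
        using arg_cong[OF card_located_swap[OF ops i, of w X], of real] by simp
      moreover have "snd i \<in> R (fst i)"
        if sh: "short l (outcome ops i w)"
          and light: "\<not> (\<exists>p. outcome ops i w = Some p \<and> dereference T n w (snd i) p \<in> X)"
      proof -
        obtain p where p: "outcome ops i w = Some p" "length p \<le> l"
          using sh by (auto simp: short_def)
        note sl = outcome_slot[OF ops i w p(1)]
        have "dereference T n w (snd i) p \<notin> slot w ops ` (D - {fst i})"
        proof
          assume "dereference T n w (snd i) p \<in> slot w ops ` (D - {fst i})"
          then obtain k where "k \<in> D - {fst i}" "dereference T n w (snd i) p = slot w ops k" by blast
          then show False using sl(2)[of k "the (P k)"] by (auto simp: D_def P_def slot_def)
        qed
        then have "dereference T n w (snd i) p \<in> F (fst i) - X"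
          using light p sl(1) by (auto simp: F_def)
        then show ?thesis using i p(2) by (auto simp: R_def choices_def)
      qed
      ultimately show ?thesis by (auto simp: of_bool_def split: if_splits)
    qed
    have sumR: "(\<Sum>i\<in>choices ops. of_bool (snd i \<in> R (fst i))) \<le>
        m * ((real n - m + 1 + card (failed w ops)) * \<theta>)"
    proof (rule sum_choices_le[OF ops])
      fix y
      have "(U - live ops) \<inter> R y = R y" by (auto simp: R_def)
      then show "(\<Sum>k\<in>U - live ops. of_bool (snd (y, k) \<in> R (fst (y, k)))) \<le>
          (real n - m + 1 + card (failed w ops)) * \<theta>"
        using R_card[of y] finite_U by simp
    qed
    \<comment> \<open>Few heavy slots hold few live keys, and a uniformly chosen key rarely is one
      of them: this bounds the outflow.\<close>
    have "card (located w X ops) \<le> card X"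
      using good_legal[OF ops] w by (intro card_located_le) (auto simp: X_def)
    then have loc: "card (located w X ops) \<le> n * 2 ^ (l + 1) / M" using X_card by linarith
    have "(\<Sum>i\<in>choices ops. of_bool (short l (outcome ops i w))) \<le> \<Delta> +
        (\<Sum>i\<in>choices ops. of_bool (fst i \<in> located w X ops)) +
        (\<Sum>i\<in>choices ops. of_bool (snd i \<in> R (fst i)))"
      unfolding \<Delta>_def sum.distrib[symmetric] by (rule sum_mono[OF pt])
    also have "\<dots> \<le> \<Delta> + real (card U - m) * (n * 2 ^ (l + 1) / M) +
        m * ((real n - m + 1 + card (failed w ops)) * \<theta>)"
      unfolding sum_located[OF ops] using sumR loc
      by (intro add_mono order_refl mult_left_mono) auto
    also have "m * ((real n - m + 1 + card (failed w ops)) * \<theta>) \<le>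
        m * ((real n - m + 1 + card (failed w ops)) * (2 * M / n * real (card U - m)))"
    proof -
      \<comment> \<open>Any key serves here: the expression dominates a cardinality.\<close>
      have "0 \<le> real n - m + 1 + card (failed w ops)"
        using F_card[of undefined] by linarith
      have "u \<le> 2 * real (card U - m)" using U_large by (simp add: u_def)
      then have "M / n * u \<le> M / n * (2 * real (card U - m))"
        using M by (intro mult_left_mono) auto
      then have "\<theta> \<le> 2 * M / n * real (card U - m)" by (simp add: \<theta>_def ac_simps)
      then show ?thesis using \<open>0 \<le> real n - m + 1 + card (failed w ops)\<close>
        by (intro mult_left_mono) auto
    qed
    finally have "(\<Sum>i\<in>choices ops. of_bool (short l (outcome ops i w))) \<le>
        \<Delta> + real (card U - m) * (n * 2 ^ (l + 1) / M) +
        m * ((real n - m + 1 + card (failed w ops)) * (2 * M / n * real (card U - m)))" by simp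
    also have "\<dots> = (n * 2 ^ (l + 1) / (M * m) + 2 * M / n * (real n - m + 1) +
          2 * M / n * card (failed w ops)) * card (choices ops) + 1 * \<Delta>"
      using m_pos M n_pos by (simp add: card_choices[OF ops] field_simps)
    finally show "(\<Sum>i\<in>choices ops. of_bool (short l (outcome ops i w))) \<le>
        (n * 2 ^ (l + 1) / (M * m) + 2 * M / n * (real n - m + 1) +
          2 * M / n * card (failed w ops)) * card (choices ops) +
        1 * (\<Sum>i\<in>choices ops. real (card (located w X (swap ops i))) - card (located w X ops))"
      unfolding \<Delta>_def .
  qed (auto simp: X_def)
qed simp

text \<open>
  Here a slot is heavy if it is the empty-pointer slot of at least half as many keys as average.
  At least half of the keys have a heavy empty-pointer slot, so if most allocations return the
  empty pointer, a constant fraction of the live keys sits in heavy slots, and a fresh key collides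
  with one of them with constant probability. The weight \<open>b\<close> makes the coefficients of the number
  of live keys in heavy slots cancel.
\<close>
lemma constant_load_bound:
  fixes \<phi> \<sigma> :: real
  assumes load: "supports_load_factor T U n q \<delta> \<phi>"
    and size: "expected_pointer_size_le T U n q \<delta> \<sigma>"
    and U_large: "n\<^sup>2 \<le> card U" and "2 \<le> n" and "m \<le> n"
  shows "m / (8 * n) \<le> \<phi> + \<sigma> + 5 / n"
proof -
  define b where "b = real m / (4 * n)"
  have b: "0 \<le> b" "b \<le> 1 / 4" using \<open>m \<le> n\<close> n_pos by (simp_all add: b_def field_simps)
  \<comment> \<open>With \<open>l = 0\<close> only the empty string is short. Both estimates below
    count only keys that hold a slot, which is why \<kappa> is 0.\<close>
  have "1 - \<phi> - \<sigma> / (real 0 + 1) - 0 * real m * \<phi> \<le> 1 - b / 2 + 5 / n"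
  proof (rule churn_bound[OF load size order_refl b(1)])
    fix w assume w: "w \<in> space (rand T)"
    define u N where "u = real (card U)" and "N = real (card U - m)"
    define h where "h k = dereference T n w k []" for k
    have reach: "reach 0 w x = {k \<in> U. h k = x}" for x by (auto simp: reach_def h_def)
    have nn: "2 * m \<le> card U"
    proof -
      have "2 * m \<le> n * n" using \<open>2 \<le> n\<close> \<open>m \<le> n\<close> by (intro mult_le_mono)
      then show ?thesis using U_large by (simp add: power2_eq_square)
    qed
    then have uN: "u = N + m" "u \<le> 2 * N" using m_less by (simp_all add: u_def N_def)
    \<comment> \<open>The quadratic size of the universe enters here: live keys amount to only
      O(1/n) of the fresh ones.\<close>
    have N: "0 < N" "2 * real m \<le> 4 / n * N"
    proof -
      show "0 < N" using m_less by (simp add: N_def)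
      have "real n * n \<le> u" using U_large unfolding u_def power2_eq_square
        by (metis of_nat_le_iff of_nat_mult)
      then have "real m * n \<le> 2 * N" using \<open>m \<le> n\<close> uN
        by (meson mult_right_mono of_nat_0_le_iff of_nat_le_iff order_trans)
      then show "2 * real m \<le> 4 / n * N" using n_pos by (simp add: field_simps)
    qed
    define X where "X = {x \<in> {..<n}. u / (2 * n) \<le> card (reach 0 w x)}"
    have light: "card {k \<in> U. h k \<in> {..<n} - X} \<le> u / 2"
    proof -
      have "card {k \<in> U. h k \<in> {..<n} - X} = card (\<Union>x\<in>{..<n} - X. reach 0 w x)"
        by (rule arg_cong[of _ _ card]) (auto simp: reach)
      also have "\<dots> \<le> (\<Sum>x\<in>{..<n} - X. card (reach 0 w x))" by (rule card_UN_le) simp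
      finally have "real (card {k \<in> U. h k \<in> {..<n} - X}) \<le> (\<Sum>x\<in>{..<n} - X. real (card (reach 0 w x)))"
        by (metis of_nat_le_iff of_nat_sum)
      also have "\<dots> \<le> card ({..<n} - X) * (u / (2 * n))"
        by (rule sum_bounded_above[where 'a = real, simplified]) (auto simp: X_def)
      also have "\<dots> \<le> n * (u / (2 * n))"
        using card_mono[of "{..<n}" "{..<n} - X"] by (intro mult_right_mono) (auto simp: u_def)
      finally show ?thesis using n_pos by simp
    qed
    \<comment> \<open>A key has just one empty-pointer slot, so the sets \<open>reach 0 w x\<close>
      are disjoint and their lower bounds add up; with longer pointers they could overlap.\<close>
    have heavy: "card Y * (u / (2 * n)) \<le> card {k \<in> U. h k \<in> Y}" if "Y \<subseteq> X" for Y
    proof -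
      have fin: "finite Y" using that by (rule finite_subset) (simp add: X_def)
      have "card Y * (u / (2 * n)) \<le> (\<Sum>x\<in>Y. real (card (reach 0 w x)))"
        using that by (intro sum_bounded_below[where 'a = real, simplified]) (auto simp: X_def)
      also have "\<dots> = real (card (\<Union>x\<in>Y. reach 0 w x))"
        using fin finite_U by (subst card_UN_disjoint) (auto simp: reach)
      also have "(\<Union>x\<in>Y. reach 0 w x) = {k \<in> U. h k \<in> Y}" by (auto simp: reach)
      finally show ?thesis .
    qed
    show "\<exists>X\<subseteq>{..<n}. \<forall>ops. good ops \<longrightarrow>
      (\<Sum>i\<in>choices ops. of_bool (short 0 (outcome ops i w))) \<le>
        (1 - b / 2 + 5 / n + 0 * real (card (failed w ops))) * card (choices ops) +
        b * (\<Sum>i\<in>choices ops. real (card (located w X (swap ops i))) - card (located w X ops))"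
    proof (intro exI[of _ X] conjI allI impI)
      fix ops assume ops: "good ops"
      define H where "H = real (card (located w X ops))"
      define S where "S = (\<Sum>i\<in>choices ops. of_bool (short 0 (outcome ops i w)) :: real)"
      define \<Delta> where "\<Delta> = (\<Sum>i\<in>choices ops. real (card (located w X (swap ops i))) - card (located w X ops))"
      define Y where "Y y = slot w ops ` (located w X ops - {y})" for y
      have fin: "finite (located w X ops)"
        using located_subset_live[OF good_legal[OF ops]] by (rule finite_subset) simp
      have short_h: "outcome ops i w = Some []" if "short 0 (outcome ops i w)" for i
        using that by (auto simp: short_def)
      have Y_card: "H - 1 \<le> card (Y y)" for y
      proof -
        have "card (Y y) = card (located w X ops - {y})"
          unfolding Y_def using inj_on_slot[OF good_legal[OF ops] w]
          by (intro card_image) (auto intro: inj_on_subset simp: located_def)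
        moreover have "card (located w X ops) \<le> card (located w X ops - {y}) + 1"
          using diff_card_le_card_Diff[of "{y}" "located w X ops"] by simp
        ultimately show ?thesis by (simp add: H_def)
      qed
      have Y_sub: "Y y \<subseteq> X" for y by (auto simp: Y_def located_def slot_def)
      have "S \<le> (\<Sum>i\<in>choices ops. (real (card (located w X (swap ops i))) - card (located w X ops)) +
          of_bool (fst i \<in> located w X ops) + of_bool (h (snd i) \<in> {..<n} - X))"
        unfolding S_def
      proof (rule sum_mono)
        fix i assume i: "i \<in> choices ops"
        have "real (card (located w X (swap ops i))) + of_bool (fst i \<in> located w X ops) =
            card (located w X ops) +
            of_bool (\<exists>p. outcome ops i w = Some p \<and> dereference T n w (snd i) p \<in> X)"
          using arg_cong[OF card_located_swap[OF ops i, of w X], of real] by simp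
        \<comment> \<open>A key whose empty pointer leads outside the store never receives it, so
          for a short outcome \<open>h\<close> is a heavy or a light slot.\<close>
        moreover have "h (snd i) < n \<and> (h (snd i) \<in> X \<longrightarrow>
            (\<exists>p. outcome ops i w = Some p \<and> dereference T n w (snd i) p \<in> X))"
          if "short 0 (outcome ops i w)"
          using short_h[OF that] outcome_slot(1)[OF ops i w] by (auto simp: h_def)
        ultimately show "of_bool (short 0 (outcome ops i w)) \<le>
          (real (card (located w X (swap ops i))) - card (located w X ops)) +
          of_bool (fst i \<in> located w X ops) + of_bool (h (snd i) \<in> {..<n} - X)"
          by (auto simp: of_bool_def split: if_splits)
      qed
      also have "\<dots> \<le> \<Delta> + N * H + m * (u / 2)"
      proof -
        have "(\<Sum>i\<in>choices ops. of_bool (h (snd i) \<in> {..<n} - X)) \<le> m * (u / 2)"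
        proof (rule sum_choices_le[OF ops])
          fix y
          have "card ((U - live ops) \<inter> {k. h k \<in> {..<n} - X}) \<le> card {k \<in> U. h k \<in> {..<n} - X}"
            using finite_U by (intro card_mono) auto
          then show "(\<Sum>k\<in>U - live ops. of_bool (h (snd (y, k)) \<in> {..<n} - X)) \<le> u / 2"
            using light finite_U by (simp del: Diff_iff)
        qed
        then show ?thesis
          by (simp only: sum.distrib \<Delta>_def[symmetric] sum_located[OF ops] N_def H_def)
      qed
      finally have drift: "S \<le> \<Delta> + N * H + m * (u / 2)" .
      \<comment> \<open>A fresh key with \<open>h\<close> in an occupied heavy slot cannot get the
        empty pointer. The \<open>- 1\<close> allows for the removed key, the \<open>+ m\<close> for
        live keys counted by \<open>heavy\<close>.\<close>
      have collide: "S \<le> m * (N - (H - 1) * (u / (2 * n)) + m)"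
        unfolding S_def
      proof (rule sum_choices_le[OF ops])
        fix y assume y: "y \<in> live ops"
        have "(\<Sum>k\<in>U - live ops. of_bool (short 0 (outcome ops (y, k) w)) :: real) \<le>
            (\<Sum>k\<in>U - live ops. 1 - of_bool (h k \<in> Y y))"
        proof (rule sum_mono)
          fix k assume "k \<in> U - live ops"
          then have i: "(y, k) \<in> choices ops" using y by (simp add: choices_def)
          have "h k \<notin> Y y" if "short 0 (outcome ops (y, k) w)"
          proof
            assume "h k \<in> Y y"
            then obtain k' where "k' \<in> located w X ops - {y}" "h k = slot w ops k'"
              unfolding Y_def by blast
            then show False using outcome_slot(2)[OF ops i w short_h[OF that], of k']
              by (auto simp: h_def slot_def located_def)
          qed
          then show "of_bool (short 0 (outcome ops (y, k) w)) \<le> 1 - (of_bool (h k \<in> Y y) :: real)"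
            by (simp add: of_bool_def)
        qed
        also have "\<dots> = N - card ((U - live ops) \<inter> {k. h k \<in> Y y})"
          using finite_U by (simp add: sum_subtractf N_def good_card_diff[OF ops])
        also have "\<dots> \<le> N - (H - 1) * (u / (2 * n)) + m"
        proof -
          have "card {k \<in> U. h k \<in> Y y} \<le> card (((U - live ops) \<inter> {k. h k \<in> Y y}) \<union> live ops)"
            using finite_U by (intro card_mono) auto
          also have "\<dots> \<le> card ((U - live ops) \<inter> {k. h k \<in> Y y}) + m"
            using card_Un_le[of _ "live ops"] by (simp add: good_card[OF ops])
          finally have "card {k \<in> U. h k \<in> Y y} \<le> card ((U - live ops) \<inter> {k. h k \<in> Y y}) + m" .
          moreover have "(H - 1) * (u / (2 * n)) \<le> card (Y y) * (u / (2 * n))"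
            using Y_card by (intro mult_right_mono) (auto simp: u_def)
          ultimately show ?thesis using heavy[OF Y_sub, of y] by linarith
        qed
        finally show "(\<Sum>k\<in>U - live ops. of_bool (short 0 (outcome ops (y, k) w)))
            \<le> N - (H - 1) * (u / (2 * n)) + m" .
      qed
      \<comment> \<open>Mixing the two estimates: only \<open>drift\<close> contains the net flow,
        so it appears with exactly the weight \<open>b\<close> of the potential.\<close>
      have "S = (1 - b) * S + b * S" by (simp add: algebra_simps)
      also have "\<dots> \<le> (1 - b) * (m * (N - (H - 1) * (u / (2 * n)) + m)) + b * (\<Delta> + N * H + m * (u / 2))"
        using b collide drift by (intro add_mono mult_left_mono) auto
      also have "\<dots> \<le> (1 - b / 2 + 5 / n) * (m * N) + b * \<Delta>"
      proof -
        \<comment> \<open>\<open>drift\<close> adds \<open>m * N * H / (4 * n)\<close>. Since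
          \<open>1 - b\<close> is at least 1/2 and \<open>u\<close> at least \<open>N\<close>,
          \<open>collide\<close> removes at least as much.\<close>
        have bH: "b * N * H = m * (N * H / (4 * n))" by (simp add: b_def)
        have H0: "0 \<le> H" by (simp add: H_def)
        have regroup: "(1 - b) * (N - (H - 1) * v + m) + x + z =
            ((1 - b) * (N + v + m) + x) + (z - (1 - b) * (H * v))" for v x z :: real
          by (simp add: algebra_simps)
        have "N * H / (4 * n) \<le> (1 - b) * (H * (u / (2 * n)))"
        proof -
          have "N * H / (4 * n) \<le> (1/2) * (H * (u / (2 * n)))"
            using uN H0 n_pos by (simp add: field_simps)
          also have "\<dots> \<le> (1 - b) * (H * (u / (2 * n)))"
            using b H0 by (intro mult_right_mono) (auto simp: u_def)
          finally show ?thesis .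
        qed
        moreover have "(1 - b) * (N + u / (2 * n) + m) + b * (u / 2) \<le> (1 - b / 2 + 5 / n) * N"
        proof -
          \<comment> \<open>Origin of \<open>5 / n\<close>: the \<open>- 1\<close> beside
            \<open>H\<close> costs \<open>N / n\<close>, and the terms in \<open>m\<close> cost at
            most \<open>2 * m\<close>, hence \<open>4 / n * N\<close>. The gain \<open>b / 2\<close>
            comes from \<open>(1 - b) * N + b * N / 2\<close>.\<close>
          have gen: "x + y + t / 2 \<le> x + e + d"
            if "a \<le> d" "y \<le> a + z" "t \<le> z" "2 * z \<le> e" "0 \<le> z" for x y t e d a z :: real
            using that by linarith
          have "(1 - b) * (N + u / (2 * n) + m) + b * (u / 2) =
              (N - b / 2 * N) + (1 - b) * (u / (2 * n) + m) + b * m / 2"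
            by (simp add: uN(1) field_simps)
          also have "\<dots> \<le> (N - b / 2 * N) + 4 / n * N + N / n"
          proof (rule gen)
            show "u / (2 * n) \<le> N / n" using uN n_pos by (simp add: field_simps)
            show "(1 - b) * (u / (2 * n) + m) \<le> u / (2 * n) + m"
              using b by (intro mult_left_le_one_le) (auto simp: u_def)
            show "b * m \<le> real m" using b by (intro mult_left_le_one_le) auto
          qed (use N in auto)
          also have "\<dots> = (1 - b / 2 + 5 / n) * N"
            by (simp add: algebra_simps add_divide_distrib[symmetric])
          finally show ?thesis .
        qed
        ultimately have "(1 - b) * (N - (H - 1) * (u / (2 * n)) + m) + b * (u / 2) + N * H / (4 * n)
            \<le> (1 - b / 2 + 5 / n) * N"
          unfolding regroup by linarith
        then have "m * ((1 - b) * (N - (H - 1) * (u / (2 * n)) + m) + b * (u / 2) + N * H / (4 * n))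
            \<le> m * ((1 - b / 2 + 5 / n) * N)"
          by (rule mult_left_mono) simp
        then show ?thesis using bH by (simp add: algebra_simps)
      qed
      also have "m * N = card (choices ops)" by (simp add: card_choices[OF ops] N_def)
      finally show "(\<Sum>i\<in>choices ops. of_bool (short 0 (outcome ops i w))) \<le>
        (1 - b / 2 + 5 / n + 0 * real (card (failed w ops))) * card (choices ops) +
        b * (\<Sum>i\<in>choices ops. real (card (located w X (swap ops i))) - card (located w X ops))"
        by (simp add: S_def \<Delta>_def)
    qed (auto simp: X_def)
  qed
  then show ?thesis by (simp add: b_def)
qed

section \<open>Choosing the heaviness threshold\<close>

lemma failure_nonneg:
  assumes "supports_load_factor T U n q \<delta> \<phi>"
  shows "0 \<le> \<phi>"
proof -
  obtain ops where ops: "good ops" using good_exists by blast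
  then obtain k where "k \<in> live ops" using m_pos good_card[OF ops] by fastforce
  from prob_pointer_None(2)[OF assms good_legal[OF ops] this]
  show ?thesis by (rule order_trans[rotated]) simp
qed

text \<open>With \<open>M = 8 * 2 ^ (l + 1)\<close> at most \<open>n / 8\<close> slots are heavy, so
  they absorb at most 1/4 of the allocations as \<open>n \<le> 2 * m\<close>. The light slots give
  16 times 3; the failure terms, at most 17, are rounded up to the same 48.\<close>

lemma high_load_bound:
  fixes \<phi> \<sigma> :: real
  assumes load: "supports_load_factor T U n q \<delta> \<phi>"
    and size: "expected_pointer_size_le T U n q \<delta> \<sigma>"
    and U_large: "2 * m \<le> card U" and m: "m \<le> n" "n \<le> 2 * m"
    and free: "real n - m + 1 \<le> 3 * \<delta> * n"
  shows "3 / 4 - 48 * 2 ^ (l + 1) * (\<delta> + \<phi>) \<le> \<sigma> / (real l + 1)"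
proof -
  define L :: real where "L = 2 ^ (l + 1)"
  have L: "1 \<le> L" unfolding L_def by (rule one_le_power) simp
  have \<phi>: "0 \<le> \<phi>" by (rule failure_nonneg[OF load])
  have "1 - \<phi> - \<sigma> / (real l + 1) - 2 * (8 * L) / n * m * \<phi> \<le>
    n * L / (8 * L * m) + 2 * (8 * L) / n * (real n - m + 1)"
    using heavy_light_bound[OF load size U_large, of "8 * L" l] L by (simp add: L_def)
  moreover have "n * L / (8 * L * m) \<le> 1 / 4"
    using L m(2) m_pos by (simp add: field_simps)
  moreover have "2 * (8 * L) / n * (real n - m + 1) \<le> 2 * (8 * L) / n * (3 * \<delta> * n)"
    using free L by (intro mult_left_mono) auto
  moreover have "2 * (8 * L) / n * (3 * \<delta> * n) = 48 * L * \<delta>"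
    using n_pos by simp
  moreover have "2 * (8 * L) / n * m * \<phi> \<le> 16 * L * \<phi>"
    using m(1) n_pos L \<phi> by (intro mult_right_mono) (auto simp: field_simps)
  moreover have "\<phi> \<le> L * \<phi>" "0 \<le> L * \<phi>"
    using L \<phi> mult_right_mono[of 1 L \<phi>] by auto
  ultimately have "3 / 4 - 48 * (L * \<delta>) - 48 * (L * \<phi>) \<le> \<sigma> / (real l + 1)" by linarith
  then show ?thesis by (simp add: L_def algebra_simps)
qed

end

subsection \<open>Asymptotics\<close>

text \<open>Half of the exponent \<open>a\<close> pays for the strings,
  \<open>2 ^ l \<le> \<delta> powr (- (a / 2))\<close>, and the other half keeps the product with
  \<open>\<delta> + \<phi>\<close> small. The constant 384 is 8 times 48, so that the subtracted
  term is at most 1/4 and 1/2 remains.\<close>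

lemma size_ge_log:
  fixes \<delta> \<phi> \<sigma> a K :: real
  assumes \<delta>: "0 < \<delta>" "\<delta> \<le> 1" and a: "0 < a" "a \<le> 1" and K: "0 \<le> K"
    and \<phi>: "\<phi> \<le> K * \<delta> powr a"
    and small: "\<delta> powr (a / 2) \<le> 1 / (384 * (1 + K))"
    and bound: "\<And>l. 3 / 4 - 48 * 2 ^ (l + 1) * (\<delta> + \<phi>) \<le> \<sigma> / (real l + 1)"
  shows "a / 4 * log 2 (1 / \<delta>) \<le> \<sigma>"
proof -
  define y where "y = a / 2 * log 2 (1 / \<delta>)"
  have y: "0 \<le> y" using \<delta> a by (simp add: y_def)
  define l where "l = nat \<lfloor>y\<rfloor>"
  have l: "real l \<le> y" "y \<le> real l + 1" using y unfolding l_def by linarith+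
  have pos: "0 < 384 * (1 + K)" using K by simp
  have "\<delta> powr 1 \<le> \<delta> powr a" using \<delta> a by (intro powr_mono') auto
  then have "\<delta> + \<phi> \<le> (1 + K) * \<delta> powr a" using \<phi> \<delta> by (simp add: algebra_simps)
  then have "2 ^ (l + 1) * (\<delta> + \<phi>) \<le> 2 ^ (l + 1) * ((1 + K) * \<delta> powr a)"
    by (rule mult_left_mono) simp
  also have "\<dots> \<le> (2 * \<delta> powr (- (a / 2))) * ((1 + K) * \<delta> powr a)"
  proof (rule mult_right_mono)
    have "(2::real) ^ (l + 1) = 2 * 2 powr real l" by (simp add: powr_realpow)
    also have "2 powr real l \<le> 2 powr y" using l by simp
    also have "2 powr y = \<delta> powr (- (a / 2))"
      using \<delta> by (simp add: y_def powr_def log_def ln_div)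
    finally show "(2::real) ^ (l + 1) \<le> 2 * \<delta> powr (- (a / 2))" by simp
  qed (use K in simp)
  also have "\<dots> = 2 * (1 + K) * (\<delta> powr (- (a / 2)) * \<delta> powr a)" by simp
  also have "\<delta> powr (- (a / 2)) * \<delta> powr a = \<delta> powr (a / 2)"
    by (simp add: powr_add[symmetric])
  also have "2 * (1 + K) * \<delta> powr (a / 2) \<le> 2 * (1 + K) * (1 / (384 * (1 + K)))"
    using small K by (intro mult_left_mono) auto
  also have "\<dots> = 1 / 192" using K by simp
  finally have "48 * 2 ^ (l + 1) * (\<delta> + \<phi>) \<le> 1 / 4" by simp
  then have "1 / 2 \<le> \<sigma> / (real l + 1)" using bound[of l] by linarith
  then have "(real l + 1) / 2 \<le> \<sigma>" by (simp add: field_simps)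
  moreover have "y / 2 \<le> (real l + 1) / 2" using l(2) by simp
  ultimately have "y / 2 \<le> \<sigma>" by (rule order_trans[rotated])
  moreover have "a / 4 * log 2 (1 / \<delta>) = y / 2" by (simp add: y_def)
  ultimately show ?thesis by (simp only:)
qed

theorem theorem3:
  "\<exists>C::nat. \<forall>(T :: ('k, 'r, 's) deref_table) (U :: nat \<Rightarrow> 'k set) (q :: nat \<Rightarrow> nat)
      (\<delta> :: nat \<Rightarrow> real) (s :: nat \<Rightarrow> real) (fail :: nat \<Rightarrow> real) (a :: real).
     (\<forall>\<^sub>F n in sequentially. finite (U n) \<and> n ^ C \<le> card (U n)) \<longrightarrow>
     (\<forall>\<^sub>F n in sequentially. 1 / real n \<le> \<delta> n \<and> \<delta> n \<le> 1) \<longrightarrow>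
     (\<lambda>n. 1 - \<delta> n) \<in> \<Omega>(\<lambda>_. 1) \<longrightarrow>
     a > 0 \<longrightarrow> fail \<in> O(\<lambda>n. 1 / real n powr a) \<longrightarrow>
     (\<forall>\<^sub>F n in sequentially.
        is_dereference_table T (U n) n (q n) (\<delta> n) \<and>
        supports_load_factor T (U n) n (q n) (\<delta> n) (fail n) \<and>
        expected_pointer_size_le T (U n) n (q n) (\<delta> n) (s n)) \<longrightarrow>
     s \<in> \<Omega>(\<lambda>n. log 2 (1 / \<delta> n))"
proof (intro exI[of _ 2] allI impI)
  fix T :: "('k, 'r, 's) deref_table" and U :: "nat \<Rightarrow> 'k set" and q :: "nat \<Rightarrow> nat"
    and \<delta> s fail :: "nat \<Rightarrow> real" and a :: real
  assume U: "\<forall>\<^sub>F n in sequentially. finite (U n) \<and> n ^ 2 \<le> card (U n)"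
    and \<delta>: "\<forall>\<^sub>F n in sequentially. 1 / real n \<le> \<delta> n \<and> \<delta> n \<le> 1"
    and load: "(\<lambda>n. 1 - \<delta> n) \<in> \<Omega>(\<lambda>_. 1)"
    and a: "a > 0" and fail: "fail \<in> O(\<lambda>n. 1 / real n powr a)"
    and table: "\<forall>\<^sub>F n in sequentially.
        is_dereference_table T (U n) n (q n) (\<delta> n) \<and>
        supports_load_factor T (U n) n (q n) (\<delta> n) (fail n) \<and>
        expected_pointer_size_le T (U n) n (q n) (\<delta> n) (s n)"
  obtain c where c: "0 < c" "\<forall>\<^sub>F n in sequentially. c * norm (1::real) \<le> norm (1 - \<delta> n)"
    using load by (rule landau_omega.bigE)
  obtain K where K: "0 < K" "\<forall>\<^sub>F n in sequentially. norm (fail n) \<le> K * norm (1 / real n powr a)"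
    using fail by (rule landau_o.bigE)
  \<comment> \<open>Capping the exponent at 1 lets \<delta> itself be absorbed into
    \<open>\<delta> powr a'\<close>.\<close>
  define a' where "a' = min 1 a"
  have a': "0 < a'" "a' \<le> 1" "a' \<le> a" using a by (auto simp: a'_def)
  define E where "E = 384 * (1 + K)"
  have E: "384 \<le> E" using K by (simp add: E_def)
  \<comment> \<open>Solves \<open>\<epsilon> powr (a' / 2) = 1 / E\<close>, the smallness demanded
    by \<open>size_ge_log\<close>; for larger \<delta> the logarithm is at most \<Lambda>, so a
    constant lower bound on the size suffices.\<close>
  define \<epsilon> where "\<epsilon> = (1 / E) powr (2 / a')"
  have "\<epsilon> \<le> (1 / E) powr 1"
    unfolding \<epsilon>_def using E a' by (intro powr_mono') (auto simp: field_simps)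
  also have "\<dots> \<le> 1 / 4" using E by (simp add: field_simps)
  finally have \<epsilon>: "0 < \<epsilon>" "\<epsilon> \<le> 1 / 4" using E by (simp_all add: \<epsilon>_def)
  have \<epsilon>_powr: "\<epsilon> powr (a' / 2) = 1 / E" using E a' by (simp add: \<epsilon>_def powr_powr)
  define \<Lambda> where "\<Lambda> = log 2 (1 / \<epsilon>)"
  have \<Lambda>: "0 < \<Lambda>" using \<epsilon> by (simp add: \<Lambda>_def)
  define C where "C = min (a' / 4) (c / 16 / \<Lambda>)"
  have C: "0 < C" using a' c \<Lambda> by (simp add: C_def)
  \<comment> \<open>Error budget of the constant regime: \<open>c / 8\<close> loses
    \<open>c / 32\<close> to \<open>6 / n\<close> (rounding included) and \<open>c / 32\<close> to
    failures, leaving \<open>c / 16\<close>.\<close>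
  have lim1: "\<forall>\<^sub>F n in sequentially. 6 / real n < c / 32"
    using c by real_asymp
  have lim2: "\<forall>\<^sub>F n in sequentially. K * (1 / real n powr a) < c / 32"
  proof (rule order_tendstoD(2))
    show "(\<lambda>n. K * (1 / real n powr a)) \<longlonglongrightarrow> 0" using a by real_asymp
  qed (use c in simp)
  have lim3: "\<forall>\<^sub>F n in sequentially. 1 \<le> c * real n" using c by real_asymp
  have lim4: "\<forall>\<^sub>F n in sequentially. 4 \<le> n" by (rule eventually_ge_at_top)
  have "\<forall>\<^sub>F n in sequentially. C * norm (log 2 (1 / \<delta> n)) \<le> norm (s n)"
    using U \<delta> c(2) K(2) table lim1 lim2 lim3 lim4
  proof eventually_elim
    case (elim n)
    have d: "0 < \<delta> n" "1 / n \<le> \<delta> n" "\<delta> n \<le> 1"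
      using elim by (auto intro: less_le_trans[of 0 "1 / real n"])
    have load_c: "c \<le> 1 - \<delta> n" using elim d by simp
    define m where "m = nat \<lfloor>(1 - \<delta> n) * n\<rfloor>"
    have "c * n \<le> (1 - \<delta> n) * n" using load_c by (intro mult_right_mono) auto
    then have cap1: "1 \<le> (1 - \<delta> n) * n" "c * n \<le> (1 - \<delta> n) * n" using elim by linarith+
    then have m: "real m \<le> (1 - \<delta> n) * n" "(1 - \<delta> n) * n < real m + 1" "0 < m"
      unfolding m_def by linarith+
    have "(1 - \<delta> n) * n \<le> 1 * real n" using d by (intro mult_right_mono) auto
    then have mn: "m \<le> n" using m by linarith
    have "4 * n \<le> n * n" using elim by (intro mult_right_mono) auto
    moreover have "n * n \<le> card (U n)" using elim by (simp add: power2_eq_square)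
    ultimately have card: "4 * n \<le> card (U n)" by linarith
    interpret churn T "U n" n "q n" "\<delta> n" m
      using elim m mn card by unfold_locales auto
    have L: "supports_load_factor T (U n) n (q n) (\<delta> n) (fail n)"
      and S: "expected_pointer_size_le T (U n) n (q n) (\<delta> n) (s n)"
      using elim by auto
    have fail_n: "fail n \<le> K * (1 / real n powr a)" using elim by simp
    have log0: "0 \<le> log 2 (1 / \<delta> n)" using d by simp
    have "C * log 2 (1 / \<delta> n) \<le> s n"
    proof (cases "\<delta> n \<le> \<epsilon>")
      case True
      \<comment> \<open>One unit is lost to rounding down \<open>m\<close> and one to the removed
        key; each is at most \<open>\<delta> n * n\<close>, whence the factor 3.\<close>
      have "1 \<le> \<delta> n * n" using d elim by (simp add: field_simps)
      then have free: "real n - m + 1 \<le> 3 * \<delta> n * n" using m by (simp add: algebra_simps)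
      have "\<delta> n * n \<le> 1 / 4 * n" using True \<epsilon> by (intro mult_right_mono) auto
      moreover have "(1 - \<delta> n) * n = n - \<delta> n * n" by (simp add: algebra_simps)
      moreover have "4 \<le> real n" using elim by simp
      ultimately have "real n \<le> 2 * real m" using m by linarith
      then have nm: "n \<le> 2 * m" by linarith
      have "a' / 4 * log 2 (1 / \<delta> n) \<le> s n"
      proof (rule size_ge_log[where \<phi> = "fail n" and K = K])
        have "1 / real n powr a = (1 / real n) powr a" by (simp add: powr_divide)
        also have "\<dots> \<le> \<delta> n powr a" using d a by (intro powr_mono2) auto
        also have "\<dots> \<le> \<delta> n powr a'" using d a' by (intro powr_mono') auto
        finally show "fail n \<le> K * \<delta> n powr a'"
          using fail_n K(1) by (meson mult_left_mono less_imp_le order_trans)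
        have "\<delta> n powr (a' / 2) \<le> \<epsilon> powr (a' / 2)" using True d a' by (intro powr_mono2) auto
        then show "\<delta> n powr (a' / 2) \<le> 1 / (384 * (1 + K))" by (simp add: \<epsilon>_powr E_def)
        show "3 / 4 - 48 * 2 ^ (l + 1) * (\<delta> n + fail n) \<le> s n / (real l + 1)" for l
          using high_load_bound[OF L S _ mn nm free] card mn by simp
      qed (use d a' K in auto)
      moreover have "C * log 2 (1 / \<delta> n) \<le> a' / 4 * log 2 (1 / \<delta> n)"
        using log0 by (intro mult_right_mono) (auto simp: C_def)
      ultimately show ?thesis by linarith
    next
      case False
      have "m / (8 * n) \<le> fail n + s n + 5 / n"
        using elim mn by (intro constant_load_bound[OF L S]) auto
      moreover have "c / 8 - 1 / n \<le> m / (8 * n)"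
      proof -
        have "(c * n - 1) / (8 * n) \<le> m / (8 * n)"
          using cap1 m by (intro divide_right_mono) auto
        moreover have "(c * n - 1) / (8 * n) = c / 8 - 1 / (8 * n)"
          using elim by (simp add: diff_divide_distrib)
        moreover have "1 / (8 * n) \<le> 1 / real n" using elim by (simp add: field_simps)
        ultimately show ?thesis by linarith
      qed
      moreover have "6 / real n = 5 / n + 1 / n" by simp
      ultimately have "c / 16 \<le> s n" using elim(6,7) fail_n by linarith
      have "log 2 (1 / \<delta> n) \<le> \<Lambda>"
        unfolding \<Lambda>_def using False d \<epsilon> by (subst log_le_cancel_iff) (auto simp: field_simps)
      then have "C * log 2 (1 / \<delta> n) \<le> C * \<Lambda>" using C by simp
      also have "\<dots> \<le> c / 16 / \<Lambda> * \<Lambda>" using \<Lambda> by (intro mult_right_mono) (auto simp: C_def)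
      also have "\<dots> = c / 16" using \<Lambda> by simp
      finally show ?thesis using \<open>c / 16 \<le> s n\<close> by linarith
    qed
    then show ?case using log0 by simp
  qed
  then show "s \<in> \<Omega>(\<lambda>n. log 2 (1 / \<delta> n))"
    using C by (rule landau_omega.bigI[rotated])
qed

end
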